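(* Let $m\ge1$, $L\ge1$, $T>0$, $\delta\ge0$ and $r>0$, with $r$ small enough that $\mathcal{M}_0,\ldots,\mathcal{M}_{2m-2}$ are analytic in a neighbourhood of the closed disk $\{|s|\le r\}$, and assume that $\Delta_m$ has no zeros on $\Gamma_r=\{s\in\mathbb{C}:|s|=r\}$. Let $\eta_m(r,\delta,L,T)\ge0$ be a number such that $$\max_{0\le n\le 2m-2}\ \sup_{s\in\Gamma_r}\left|\mathcal{M}_n^{\delta,L,T}(s)-\mathcal{M}_n(s)\right|\le\eta_m(r,\delta,L,T).$$ Set $$B_m(r)=\sup_{s\in\Gamma_r}\max\left\{\|H_m(s)\|_2,\ \|H_m^{\delta,L,T}(s)\|_2\right\},\qquad \mu_m(r)=\min_{s\in\Gamma_r}|\Delta_m(s)| .$$ If $$m^2\,B_m(r)^{m-1}\,\eta_m(r,\delta,L,T)<\mu_m(r),$$ then $\Delta_m^{\delta,L,T}$ and $\Delta_m$ have the same number of zeros inside $\Gamma_r$, counting multiplicities. Equivalently, $$\tau_m^{\delta,L,T}(r)=\tau_m(r),$$ where $$\tau_m^{\delta,L,T}(r)=\frac1{2\pi\mathrm{i}}\oint_{\Gamma_r}\frac{(\Delta_m^{\delta,L,T})'(s)}{\Delta_m^{\delta,L,T}(s)}\,ds,\qquad \tau_m(r)=\frac1{2\pi\mathrm{i}}\oint_{\Gamma_r}\frac{\Delta_m'(s)}{\Delta_m(s)}\,ds .$$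
   Context: Identify $\mathbb{R}^2$ with $\mathbb{C}$; $\mathbb{D}$ is the open unit disk. Let $N\ge1$, $p_j=\rho_je^{\mathrm{i}\phi_j}\in\mathbb{D}$ ($0\le\rho_j<1$) and $q_j\in\mathbb{R}\setminus\{0\}$, $j=1,\ldots,N$. Let $u$ solve $\partial_tu-\Delta u=\sum_{j=1}^Nq_j\delta(x-p_j)$ in $\mathbb{D}\times(0,\infty)$ with $u=0$ on $\partial\mathbb{D}\times(0,\infty)$ and $u(\cdot,0)=0$, and let $f(\theta,t)=\frac{\partial u}{\partial\nu}(e^{\mathrm{i}\theta},t)$ be the boundary flux ($\nu$ the outward unit normal). Ideal moments: the Fourier moments $\mathcal{M}_n(s)=\frac1{2\pi}\int_0^{2\pi}\mathcal{F}(\theta,s)e^{-\mathrm{i}n\theta}d\theta$ of $\mathcal{F}(\theta,s)=s\int_0^\infty e^{-st}f(\theta,t)\,dt$, given by $$\mathcal{M}_n(s)=-\frac1{2\pi}\sum_{j=1}^{N}q_j\frac{I_n(\sqrt{s}\,\rho_j)}{I_n(\sqrt{s})}e^{-\mathrm{i}n\phi_j},\qquad n=0,1,2,\ldots,$$ with $I_n$ the modified Bessel function of the first kind; each ratio is independent of the branch of $\sqrt s$ and extends analytically to a neighbourhood of $s=0$, and $\mathcal{M}_n$ denotes the extension. $H_m(s)=(\mathcal{M}_{a+b}(s))_{a,b=0}^{m-1}$ and $\Delta_m(s)=\det H_m(s)$. Noisy discrete moments: with $\theta_\ell=2\pi(\ell-1)/L$, the data are $f_\ell^\delta(t)=f(\theta_\ell,t)+\eta_\ell(t)$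 on $(0,T)$, where $\|\eta_\ell\|_{L^2(0,T)}\le\delta$, $\ell=1,\ldots,L$. Define $$\mathcal{F}_\ell^{\delta,T}(s)=s\int_0^Te^{-st}f_\ell^\delta(t)\,dt,\qquad \mathcal{M}_n^{\delta,L,T}(s)=\frac1L\sum_{\ell=1}^L\mathcal{F}_\ell^{\delta,T}(s)e^{-\mathrm{i}n\theta_\ell},$$ $H_m^{\delta,L,T}(s)=(\mathcal{M}_{a+b}^{\delta,L,T}(s))_{a,b=0}^{m-1}$ and $\Delta_m^{\delta,L,T}(s)=\det H_m^{\delta,L,T}(s)$. $\|\cdot\|_2$ is the spectral norm; $\Gamma_r$ is positively oriented; $B_m(r)^0=1$. *)

theory Defs
  imports
    "HOL-Complex_Analysis.Complex_Analysis"
    "Jordan_Normal_Form.Determinant"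
begin

definition bessel_I :: "nat \<Rightarrow> complex \<Rightarrow> complex" where
  "bessel_I n z = (\<Sum>k. (z / 2) ^ (2 * k + n) / (fact k * fact (n + k)))"

text \<open>
  The quotients below do not depend on the branch of the square root because of this parity.
\<close>
lemma bessel_I_minus: "bessel_I n (- z) = (- 1) ^ n * bessel_I n z"
proof -
  have eq: "(- z / 2) ^ (2 * k + n) = (- 1) ^ n * (z / 2) ^ (2 * k + n)" for k
  proof -
    have "(- z / 2) ^ (2 * k + n) = (- 1) ^ (2 * k + n) * (z / 2) ^ (2 * k + n)"
      by (metis minus_divide_left mult_minus1 power_mult_distrib)
    then show ?thesis by (simp add: power_add)
  qed
  have sm: "summable (\<lambda>k. (z / 2) ^ (2 * k + n) / (fact k * fact (n + k)))"
  proof (rule summable_comparison_test')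
    define w where "w = (norm (z / 2))\<^sup>2"
    show "summable (\<lambda>k. norm (z / 2) ^ n * (inverse (fact k) * w ^ k))"
      by (intro summable_mult summable_exp)
    fix k :: nat assume "0 \<le> k"
    have "norm ((z / 2) ^ (2 * k + n) / (fact k * fact (n + k)))
        = norm (z / 2) ^ n * w ^ k / (fact k * fact (n + k))"
      by (simp add: norm_mult norm_divide norm_power w_def power_add power_mult)
    also have "\<dots> \<le> norm (z / 2) ^ n * w ^ k / fact k"
      by (rule divide_left_mono) (auto simp: w_def fact_ge_1 mult_le_cancel_left1)
    finally show "norm ((z / 2) ^ (2 * k + n) / (fact k * fact (n + k)))
        \<le> norm (z / 2) ^ n * (inverse (fact k) * w ^ k)"
      by (simp add: field_simps)
  qed
  show ?thesis
    unfolding bessel_I_def eq using suminf_mult[OF sm, of "(- 1) ^ n"] by simp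
qed

text \<open>
  The explicit formula is undefined (in HOL: has the value of a division by zero) at \<open>s = 0\<close> for
  \<open>n > 0\<close>; \<^const>\<open>remove_sings\<close> replaces the value at every point by the limit there, if it exists.
\<close>
definition ideal_moment ::
  "nat \<Rightarrow> (nat \<Rightarrow> real) \<Rightarrow> (nat \<Rightarrow> real) \<Rightarrow> (nat \<Rightarrow> real) \<Rightarrow> nat \<Rightarrow> complex \<Rightarrow> complex" where
  "ideal_moment N q \<rho> \<phi> n = remove_sings (\<lambda>s.
     - (1 / (2 * of_real pi)) *
       (\<Sum>j=1..N. of_real (q j) * (bessel_I n (csqrt s * of_real (\<rho> j)) / bessel_I n (csqrt s))
          * exp (- \<i> * of_nat n * of_real (\<phi> j))))"

subsection \<open>The heat equation with point sources\<close>

definition partial_deriv :: "'a::euclidean_space \<Rightarrow> ('a \<Rightarrow> real) \<Rightarrow> 'a \<Rightarrow> real" where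
  "partial_deriv b g x = frechet_derivative g (at x) b"

primrec C_k :: "nat \<Rightarrow> ('a::euclidean_space \<Rightarrow> real) \<Rightarrow> bool" where
  "C_k 0 g \<longleftrightarrow> continuous_on UNIV g"
| "C_k (Suc k) g \<longleftrightarrow> g differentiable_on UNIV \<and> (\<forall>b\<in>Basis. C_k k (partial_deriv b g))"

definition test_function :: "'a::euclidean_space set \<Rightarrow> ('a \<Rightarrow> real) \<Rightarrow> bool" where
  "test_function U g \<longleftrightarrow>
     (\<forall>k. C_k k g) \<and> compact (closure {x. g x \<noteq> 0}) \<and> closure {x. g x \<noteq> 0} \<subseteq> U"

definition time_deriv :: "(complex \<times> real \<Rightarrow> real) \<Rightarrow> complex \<times> real \<Rightarrow> real" where
  "time_deriv = partial_deriv (0, 1)"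

definition space_laplacian :: "(complex \<times> real \<Rightarrow> real) \<Rightarrow> complex \<times> real \<Rightarrow> real" where
  "space_laplacian g x =
     partial_deriv (1, 0) (partial_deriv (1, 0) g) x + partial_deriv (\<i>, 0) (partial_deriv (\<i>, 0) g) x"

text \<open>
  \<open>u\<close> solves \<open>\<partial>\<^sub>t u - \<Delta>u = \<Sum>\<^sub>j q\<^sub>j \<delta>(x - p\<^sub>j)\<close> in the unit disk for positive times, with zero Dirichlet
  boundary values and zero initial values.  The equation holds in the sense of distributions, the
  boundary values are attained continuously, and the initial values are attained in \<open>L\<^sup>1\<close>.
  Convergence in \<open>L\<^sup>1\<close> is needed for uniqueness: pointwise convergence away from the \<open>p\<^sub>j\<close> would allow
  adding Dirichlet heat kernels with pole at \<open>p\<^sub>j\<close>.  The values of \<open>u\<close> at the points \<open>p\<^sub>j\<close>, where the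
  solution has logarithmic singularities, are irrelevant for positive times.
\<close>
definition solves_heat_problem ::
  "nat \<Rightarrow> (nat \<Rightarrow> real) \<Rightarrow> (nat \<Rightarrow> complex) \<Rightarrow> (complex \<Rightarrow> real \<Rightarrow> real) \<Rightarrow> bool" where
  "solves_heat_problem N q p u \<longleftrightarrow>
     (\<forall>T>0. set_integrable lebesgue (ball 0 1 \<times> {0<..<T}) (\<lambda>(x, t). u x t)) \<and>
     (\<forall>g. test_function (ball 0 1 \<times> {0<..}) g \<longrightarrow>
        (LINT z:ball 0 1 \<times> {0<..}|lebesgue. u (fst z) (snd z) * (- time_deriv g z - space_laplacian g z))
          = (\<Sum>j=1..N. q j * (LINT t:{0<..}|lebesgue. g (p j, t)))) \<and>
     continuous_on ((cball 0 1 - p ` {1..N}) \<times> {0<..}) (\<lambda>(x, t). u x t) \<and>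
     (\<forall>x t. cmod x = 1 \<longrightarrow> t > 0 \<longrightarrow> u x t = 0) \<and>
     (\<forall>x\<in>ball 0 1. u x 0 = 0) \<and>
     (\<forall>t>0. set_integrable lebesgue (ball 0 1) (\<lambda>x. u x t)) \<and>
     ((\<lambda>t. LINT x:ball 0 1|lebesgue. \<bar>u x t - u x 0\<bar>) \<longlongrightarrow> 0) (at_right 0)"

text \<open>
  The outward unit normal at \<open>e\<^sup>i\<^sup>\<theta>\<close> is \<open>e\<^sup>i\<^sup>\<theta>\<close> itself, so the normal derivative is the one-sided
  radial derivative at radius 1.
\<close>
definition boundary_flux :: "(complex \<Rightarrow> real \<Rightarrow> real) \<Rightarrow> (real \<Rightarrow> real \<Rightarrow> real) \<Rightarrow> bool" where
  "boundary_flux u f \<longleftrightarrow>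
     (\<forall>\<theta>. \<forall>t>0. ((\<lambda>R. u (rcis R \<theta>) t) has_real_derivative f \<theta> t) (at_left 1))"

subsection \<open>Noisy discrete moments\<close>

definition L2_norm_le :: "real \<Rightarrow> (real \<Rightarrow> real) \<Rightarrow> real \<Rightarrow> bool" where
  "L2_norm_le T g d \<longleftrightarrow>
     set_borel_measurable lebesgue {0<..<T} g \<and>
     set_integrable lebesgue {0<..<T} (\<lambda>t. (g t)\<^sup>2) \<and>
     sqrt (LINT t:{0<..<T}|lebesgue. (g t)\<^sup>2) \<le> d"

definition sample_angle :: "nat \<Rightarrow> nat \<Rightarrow> real" where
  "sample_angle L l = 2 * pi * (real l - 1) / real L"

definition truncated_transform :: "real \<Rightarrow> (real \<Rightarrow> real) \<Rightarrow> complex \<Rightarrow> complex" where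
  "truncated_transform T g s =
     s * (LINT t:{0<..<T}|lebesgue. exp (- s * of_real t) * of_real (g t))"

definition noisy_moment ::
  "nat \<Rightarrow> real \<Rightarrow> (nat \<Rightarrow> real \<Rightarrow> real) \<Rightarrow> nat \<Rightarrow> complex \<Rightarrow> complex" where
  "noisy_moment L T fd n s =
     1 / of_nat L * (\<Sum>l=1..L. truncated_transform T (fd l) s
        * exp (- \<i> * of_nat n * of_real (sample_angle L l)))"

subsection \<open>Hankel matrices, spectral norm, zero counting\<close>

definition hankel_mat :: "nat \<Rightarrow> (nat \<Rightarrow> complex \<Rightarrow> complex) \<Rightarrow> complex \<Rightarrow> complex Matrix.mat" where
  "hankel_mat m M s = Matrix.mat m m (\<lambda>(a, b). M (a + b) s)"

definition hankel_det :: "nat \<Rightarrow> (nat \<Rightarrow> complex \<Rightarrow> complex) \<Rightarrow> complex \<Rightarrow> complex" where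
  "hankel_det m M s = Determinant.det (hankel_mat m M s)"

definition euclid_norm :: "complex Matrix.vec \<Rightarrow> real" where
  "euclid_norm v = L2_set (\<lambda>i. cmod (vec_index v i)) {..<dim_vec v}"

definition spectral_norm :: "complex Matrix.mat \<Rightarrow> real" where
  "spectral_norm A =
     (SUP v\<in>{v \<in> carrier_vec (dim_col A). euclid_norm v \<le> 1}. euclid_norm (A *\<^sub>v v))"

definition hankel_bound ::
  "nat \<Rightarrow> (nat \<Rightarrow> complex \<Rightarrow> complex) \<Rightarrow> (nat \<Rightarrow> complex \<Rightarrow> complex) \<Rightarrow> real \<Rightarrow> real" where
  "hankel_bound m M M' r =
     (SUP s\<in>sphere 0 r. max (spectral_norm (hankel_mat m M s)) (spectral_norm (hankel_mat m M' s)))"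

text \<open>The infimum is attained, since the determinant is continuous on the circle.\<close>
definition hankel_det_min :: "nat \<Rightarrow> (nat \<Rightarrow> complex \<Rightarrow> complex) \<Rightarrow> real \<Rightarrow> real" where
  "hankel_det_min m M r = (INF s\<in>sphere 0 r. cmod (hankel_det m M s))"

text \<open>Meaningful only if \<open>g\<close> has finitely many zeros in the open disk and does not vanish identically.\<close>
definition zero_count :: "(complex \<Rightarrow> complex) \<Rightarrow> real \<Rightarrow> int" where
  "zero_count g r = (\<Sum>s\<in>{s\<in>ball 0 r. g s = 0}. zorder g s)"

definition log_residue_integral :: "(complex \<Rightarrow> complex) \<Rightarrow> real \<Rightarrow> complex" where
  "log_residue_integral g r =
     1 / (2 * of_real pi * \<i>) * contour_integral (circlepath 0 r) (\<lambda>s. deriv g s / g s)"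

end

theory Submission
  imports Defs "Jordan_Normal_Form.Schur_Decomposition"
begin

text \<open>
  The noisy moments are entire: the truncated Laplace transform of an integrable function is entire,
  and that of a non-integrable one is identically zero by the convention for HOL integrals.
  Changing one Hankel matrix into the other row by row and
  applying Hadamard's inequality at every step changes the determinant by at most
  \<open>m\<^sup>2 B\<^sup>m\<^sup>-\<^sup>1 \<eta>\<close>, which is smaller than \<open>\<bar>\<Delta>\<^sub>m\<bar>\<close> on the circle, so Rouche's theorem
  applies.  Hadamard's inequality follows from the arithmetic-geometric mean inequality for the
  eigenvalues of the Gram matrix of the normalized rows.
\<close>

subsection \<open>Hadamard's inequality\<close>

text \<open>Needed to carry the diagonal sum of a matrix over to its triangular form.\<close>

lemma sum_diag_mult_commute:
  fixes A B :: "'a :: comm_ring_1 Matrix.mat"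
  assumes "A \<in> carrier_mat n n" "B \<in> carrier_mat n n"
  shows "(\<Sum>i<n. (A * B) $$ (i, i)) = (\<Sum>i<n. (B * A) $$ (i, i))"
proof -
  have "(\<Sum>i<n. (A * B) $$ (i, i)) = (\<Sum>i<n. \<Sum>k<n. A $$ (i, k) * B $$ (k, i))"
    using assms by (intro sum.cong) (auto simp: scalar_prod_def atLeast0LessThan)
  also have "\<dots> = (\<Sum>k<n. \<Sum>i<n. B $$ (k, i) * A $$ (i, k))"
    by (subst sum.swap) (simp add: mult.commute)
  also have "\<dots> = (\<Sum>k<n. (B * A) $$ (k, k))"
    using assms by (intro sum.cong) (auto simp: scalar_prod_def atLeast0LessThan)
  finally show ?thesis .
qed

text \<open>Over the complex numbers the characteristic polynomial splits, so a Schur decomposition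
  exists. Determinant and trace are similarity invariants and are read off the diagonal of the
  triangular factor. A list, not a set, records multiplicities.\<close>

lemma complex_eigenvalue_list:
  fixes A :: "complex Matrix.mat"
  assumes A: "A \<in> carrier_mat n n"
  obtains es where "length es = n" "Determinant.det A = prod_list es"
    "(\<Sum>i<n. A $$ (i, i)) = sum_list es" "\<And>e. e \<in> set es \<Longrightarrow> eigenvalue A e"
proof -
  obtain es where es: "char_poly A = (\<Prod>e\<leftarrow>es. [:- e, 1:])" "length es = n"
    using char_poly_factorized[OF A] by blast
  obtain B P Q where schur: "schur_decomposition A es = (B, P, Q)"
    by (cases "schur_decomposition A es")
  from schur_decomposition[OF A es(1) schur]
  have wit: "similar_mat_wit A B P Q" and ut: "upper_triangular B" and diag: "diag_mat B = es"
    by auto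
  note D = similar_mat_witD2[OF A wit]
  have "Determinant.det A = Determinant.det B"
    using wit by (intro det_similar) (auto simp: similar_mat_def)
  also have "\<dots> = prod_list es"
    using det_upper_triangular[OF ut] D diag by blast
  finally have det: "Determinant.det A = prod_list es" .
  \<comment> \<open>The bracketing lets \<open>P\<close> move cyclically to the right end, where it
    cancels against \<open>Q\<close>.\<close>
  have "(\<Sum>i<n. A $$ (i, i)) = (\<Sum>i<n. (P * (B * Q)) $$ (i, i))"
    using D by (simp add: assoc_mult_mat)
  also have "\<dots> = (\<Sum>i<n. ((B * Q) * P) $$ (i, i))"
    using D by (intro sum_diag_mult_commute) auto
  also have "(B * Q) * P = B"
    using D by (metis assoc_mult_mat right_mult_one_mat)
  also have "(\<Sum>i<n. B $$ (i, i)) = sum_list (diag_mat B)"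
    using D by (simp add: diag_mat_def sum_list_distinct_conv_sum_set atLeast0LessThan)
  finally have tr: "(\<Sum>i<n. A $$ (i, i)) = sum_list es" using diag by simp
  have "eigenvalue A e" if "e \<in> set es" for e
  proof -
    have "poly (char_poly A) e = 0"
      using that unfolding es(1) by (induction es) auto
    then show ?thesis using eigenvalue_root_char_poly[OF A] by simp
  qed
  with that es(2) det tr show ?thesis by blast
qed

text \<open>The arithmetic-geometric mean inequality for mean 1: multiplying the inequalities x
  \<le> exp (x - 1) leaves the exponent \<open>sum_list xs - length xs\<close>, which is 0.\<close>

lemma prod_list_le_1_of_sum_list:
  fixes xs :: "real list"
  assumes "\<And>x. x \<in> set xs \<Longrightarrow> 0 \<le> x" "sum_list xs = real (length xs)"
  shows "prod_list xs \<le> 1"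
proof -
  have "prod_list xs \<le> exp (sum_list xs - real (length xs))"
    using assms(1)
  proof (induction xs)
    case (Cons x xs)
    have "x \<le> exp (x - 1)" using exp_ge_add_one_self[of "x - 1"] by simp
    then have "x * prod_list xs \<le> exp (x - 1) * exp (sum_list xs - real (length xs))"
      using Cons by (intro mult_mono) (auto intro!: prod_list_nonneg)
    then show ?case by (simp add: exp_add[symmetric] algebra_simps)
  qed simp
  with assms(2) show ?thesis by simp
qed

text \<open>For an eigenvector v put w = A* v, with A* the conjugate transpose. Then |w|^2 = <A A*
  v, v> = e |v|^2, so e is a quotient of a nonnegative and a positive real.\<close>

lemma gram_eigenvalue_nonneg:
  fixes A :: "complex Matrix.mat"
  assumes A: "A \<in> carrier_mat n n"
    and ev: "eigenvalue (A * map_mat cnj (transpose_mat A)) e"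
  shows "e = of_real (Re e)" "0 \<le> Re e"
proof -
  define A' where "A' = map_mat cnj (transpose_mat A)"
  have A': "A' \<in> carrier_mat n n" using A by (simp add: A'_def)
  obtain v where v: "v \<in> carrier_vec n" "v \<noteq> 0\<^sub>v n" "(A * A') *\<^sub>v v = e \<cdot>\<^sub>v v"
    using ev A by (auto simp: eigenvalue_def eigenvector_def A'_def)
  define w where "w = A' *\<^sub>v v"
  have w: "w \<in> carrier_vec n" using A' v by (simp add: w_def)
  have Aw: "A *\<^sub>v w = e \<cdot>\<^sub>v v"
    using v(3) assoc_mult_mat_vec[OF A A' v(1)] by (simp add: w_def)
  have w_nth: "w $ j = (\<Sum>i<n. cnj (A $$ (i, j)) * v $ i)" if "j < n" for j
    using that A v unfolding w_def A'_def
    by (auto simp: scalar_prod_def atLeast0LessThan intro!: sum.cong)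
  have Aw_nth: "(\<Sum>j<n. A $$ (i, j) * w $ j) = e * v $ i" if "i < n" for i
  proof -
    have "(\<Sum>j<n. A $$ (i, j) * w $ j) = (A *\<^sub>v w) $ i"
      using that A w by (auto simp: scalar_prod_def atLeast0LessThan intro!: sum.cong)
    then show ?thesis using that v(1) by (simp add: Aw)
  qed
  have "of_real (\<Sum>j<n. (cmod (w $ j))\<^sup>2) = (\<Sum>j<n. w $ j * cnj (w $ j))"
    by (simp add: complex_norm_square[symmetric])
  also have "\<dots> = (\<Sum>j<n. \<Sum>i<n. A $$ (i, j) * w $ j * cnj (v $ i))"
    by (intro sum.cong refl) (simp add: w_nth sum_distrib_left mult_ac)
  also have "\<dots> = (\<Sum>i<n. (\<Sum>j<n. A $$ (i, j) * w $ j) * cnj (v $ i))"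
    by (subst sum.swap) (simp add: sum_distrib_right)
  also have "\<dots> = (\<Sum>i<n. e * (v $ i * cnj (v $ i)))"
    by (intro sum.cong refl) (simp add: Aw_nth)
  also have "\<dots> = e * of_real (\<Sum>i<n. (cmod (v $ i))\<^sup>2)"
    by (simp add: complex_norm_square[symmetric] sum_distrib_left)
  finally have eq: "of_real (\<Sum>j<n. (cmod (w $ j))\<^sup>2) = e * of_real (\<Sum>i<n. (cmod (v $ i))\<^sup>2)" .
  obtain i where i: "i < n" "v $ i \<noteq> 0"
    using v(1,2) by (metis carrier_vecD eq_vecI index_zero_vec)
  have pos: "0 < (\<Sum>i<n. (cmod (v $ i))\<^sup>2)"
    using i by (intro sum_pos2[of _ i]) auto
  define c where "c = (\<Sum>j<n. (cmod (w $ j))\<^sup>2) / (\<Sum>i<n. (cmod (v $ i))\<^sup>2)"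
  have "e = of_real c"
    using pos eq unfolding c_def of_real_divide by (metis nonzero_eq_divide_eq of_real_eq_0_iff less_irrefl)
  moreover have "0 \<le> c" unfolding c_def by (intro divide_nonneg_nonneg sum_nonneg) auto
  ultimately show "e = of_real (Re e)" "0 \<le> Re e" by auto
qed

lemma permutes_less:
  assumes "p permutes {0..<n::nat}" "i < n"
  shows "p i < n"
  using permutes_in_image[OF assms(1), of i] assms(2) by simp

lemma cnj_det:
  fixes A :: "complex Matrix.mat"
  shows "cnj (Determinant.det A) = Determinant.det (map_mat cnj A)"
proof (cases "dim_row A = dim_col A")
  case True
  have "cnj (signof p) = signof p" for p :: "nat \<Rightarrow> nat"
    by (simp add: sign_def)
  then show ?thesis
    using True by (auto simp: Determinant.det_def cnj_sum cnj_prod permutes_less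
        intro!: sum.cong prod.cong)
\<comment> \<open>A non-square matrix has determinant 0 by convention.\<close>
qed (simp add: Determinant.det_def)

text \<open>The Gram matrix has determinant |det A|^2, nonnegative eigenvalues, and trace n because
  each diagonal entry is the squared norm of a row. Its eigenvalues thus have mean 1, and their
  product is at most 1.\<close>

lemma hadamard_normalized:
  fixes A :: "complex Matrix.mat"
  assumes A: "A \<in> carrier_mat n n"
    and rows: "\<And>i. i < n \<Longrightarrow> (\<Sum>j<n. (cmod (A $$ (i, j)))\<^sup>2) = 1"
  shows "cmod (Determinant.det A) \<le> 1"
proof -
  define G where "G = A * map_mat cnj (transpose_mat A)"
  have G: "G \<in> carrier_mat n n" using A by (simp add: G_def)
  obtain es where es: "length es = n" "Determinant.det G = prod_list es"
    "(\<Sum>i<n. G $$ (i, i)) = sum_list es" "\<And>e. e \<in> set es \<Longrightarrow> eigenvalue G e"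
    using complex_eigenvalue_list[OF G] by blast
  have nonneg: "e = of_real (Re e)" "0 \<le> Re e" if "e \<in> set es" for e
    using gram_eigenvalue_nonneg[OF A] es(4)[OF that] by (auto simp: G_def)
  have es_Re: "es = map of_real (map Re es)"
    using nonneg(1) by (simp add: list_eq_iff_nth_eq)
  have "Determinant.det G = of_real (prod_list (map Re es))"
    unfolding es(2) by (subst es_Re) (induction es, auto)
  moreover have "Determinant.det G = of_real ((cmod (Determinant.det A))\<^sup>2)"
    using A by (simp add: G_def det_mult cnj_det[symmetric] det_transpose complex_norm_square[symmetric])
  ultimately have "(cmod (Determinant.det A))\<^sup>2 = prod_list (map Re es)"
    using of_real_eq_iff by metis
  also have "\<dots> \<le> 1"
  proof (rule prod_list_le_1_of_sum_list)
    have "G $$ (i, i) = 1" if "i < n" for i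
    proof -
      have "G $$ (i, i) = (\<Sum>j<n. A $$ (i, j) * cnj (A $$ (i, j)))"
        using that A unfolding G_def
        by (auto simp: scalar_prod_def atLeast0LessThan intro!: sum.cong)
      also have "\<dots> = of_real (\<Sum>j<n. (cmod (A $$ (i, j)))\<^sup>2)"
        by (simp add: complex_norm_square[symmetric])
      finally show ?thesis using rows[OF that] by simp
    qed
    then have "sum_list es = of_nat n" using es(3) by simp
    moreover have "Re (sum_list es) = sum_list (map Re es)" by (induction es) auto
    ultimately show "sum_list (map Re es) = real (length (map Re es))" using es(1) by simp
  qed (use nonneg in auto)
  finally show ?thesis by (simp add: power_le_one_iff abs_square_le_1)
qed

text \<open>Dividing each row by its norm reduces to the normalized case; a zero row, where this
  fails, makes the determinant vanish.\<close>

theorem hadamard_inequality: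
  fixes A :: "complex Matrix.mat"
  assumes A: "A \<in> carrier_mat n n"
  shows "cmod (Determinant.det A) \<le> (\<Prod>i<n. L2_set (\<lambda>j. cmod (A $$ (i, j))) {..<n})"
proof -
  define c where "c i = L2_set (\<lambda>j. cmod (A $$ (i, j))) {..<n}" for i
  have c_nonneg: "0 \<le> c i" for i by (simp add: c_def L2_set_nonneg)
  define B where "B = Matrix.mat n n (\<lambda>(i, j). A $$ (i, j) / of_real (c i))"
  show ?thesis
  proof (cases "\<exists>i<n. c i = 0")
    case True
    then obtain i where i: "i < n" "c i = 0" by blast
    then have "A $$ (i, j) = 0" if "j < n" for j
      using that by (auto simp: c_def L2_set_eq_0_iff)
    then have "(\<Prod>k=0..<n. A $$ (k, p k)) = 0" if "p permutes {0..<n}" for p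
      using that i(1) by (intro prod_zero) (auto intro!: bexI[of _ i] simp: permutes_less)
    then have "Determinant.det A = 0"
      unfolding det_def'[OF A] by (intro sum.neutral) auto
    then show ?thesis by (auto intro!: prod_nonneg simp: L2_set_nonneg)
  next
    case False
    then have c_pos: "0 < c i" if "i < n" for i
      using that c_nonneg[of i] by (metis order_le_less)
    have B: "B \<in> carrier_mat n n" by (simp add: B_def)
    have "Determinant.det A = of_real (\<Prod>i<n. c i) * Determinant.det B"
    proof -
      \<comment> \<open>Each Leibniz product takes exactly one entry from every row, so all the row
        norms factor out of it.\<close>
      have "(\<Prod>i=0..<n. A $$ (i, p i)) = of_real (\<Prod>i<n. c i) * (\<Prod>i=0..<n. B $$ (i, p i))"
        if "p permutes {0..<n}" for p
      proof -
        have "(\<Prod>i=0..<n. A $$ (i, p i)) = (\<Prod>i=0..<n. of_real (c i) * B $$ (i, p i))"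
          using that less_imp_neq[OF c_pos] by (intro prod.cong refl) (auto simp: B_def permutes_less)
        then show ?thesis by (simp add: prod.distrib atLeast0LessThan)
      qed
      then show ?thesis
        unfolding det_def'[OF A] det_def'[OF B] sum_distrib_left
        by (intro sum.cong refl) (simp add: mult_ac)
    qed
    moreover have "cmod (Determinant.det B) \<le> 1"
    proof (rule hadamard_normalized[OF B])
      fix i assume i: "i < n"
      have "(\<Sum>j<n. (cmod (B $$ (i, j)))\<^sup>2) = (\<Sum>j<n. (cmod (A $$ (i, j)))\<^sup>2) / (c i)\<^sup>2"
        using i c_nonneg by (simp add: B_def norm_divide power_divide sum_divide_distrib)
      also have "(\<Sum>j<n. (cmod (A $$ (i, j)))\<^sup>2) = (c i)\<^sup>2"
        by (simp add: c_def L2_set_def sum_nonneg)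
      finally show "(\<Sum>j<n. (cmod (B $$ (i, j)))\<^sup>2) = 1" using c_pos[OF i] by simp
    qed
    ultimately have "cmod (Determinant.det A) \<le> \<bar>\<Prod>i<n. c i\<bar> * 1"
      by (simp only: norm_mult norm_of_real) (intro mult_left_mono, auto)
    then show ?thesis
      using c_nonneg by (simp add: c_def prod_nonneg)
  qed
qed

section \<open>Perturbation of determinants\<close>

text \<open>Replaces the factors one at a time. In the induction step the old summands gain the
  factor \<open>b n\<close>, and the new one is the product of all earlier \<open>a i\<close> times
  \<open>a n - b n\<close>.\<close>

lemma prod_diff_telescope:
  fixes a b :: "nat \<Rightarrow> 'a :: comm_ring_1"
  shows "(\<Prod>i<n. a i) - (\<Prod>i<n. b i) =
    (\<Sum>k<n. \<Prod>i<n. if i < k then a i else if i = k then a i - b i else b i)"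
proof (induction n)
  case (Suc n)
  have "(\<Sum>k<n. \<Prod>i<Suc n. if i < k then a i else if i = k then a i - b i else b i)
      = ((\<Prod>i<n. a i) - (\<Prod>i<n. b i)) * b n"
    unfolding Suc.IH sum_distrib_right by (intro sum.cong refl) simp
  then show ?case by (simp add: algebra_simps)
qed simp

text \<open>The difference is a sum of n determinants, each with one row of differences and n - 1
  rows from \<open>A\<close> or \<open>B\<close>; Hadamard's inequality bounds each of them. One
  factor n counts the summands, the other comes from the norm of the difference row.\<close>

lemma det_diff_bound:
  fixes A B :: "complex Matrix.mat"
  assumes A: "A \<in> carrier_mat n n" and B: "B \<in> carrier_mat n n"
    and rowA: "\<And>i. i < n \<Longrightarrow> L2_set (\<lambda>j. cmod (A $$ (i, j))) {..<n} \<le> \<beta>"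
    and rowB: "\<And>i. i < n \<Longrightarrow> L2_set (\<lambda>j. cmod (B $$ (i, j))) {..<n} \<le> \<beta>"
    and entries: "\<And>i j. i < n \<Longrightarrow> j < n \<Longrightarrow> cmod (A $$ (i, j) - B $$ (i, j)) \<le> \<eta>"
  shows "cmod (Determinant.det A - Determinant.det B) \<le> real n ^ 2 * \<beta> ^ (n - 1) * \<eta>"
proof -
  \<comment> \<open>Hybrid matrix: rows of \<open>A\<close> above row k, the difference in row k,
    rows of \<open>B\<close> below.\<close>
  define C where "C k = Matrix.mat n n (\<lambda>(i, j). if i < k then A $$ (i, j)
    else if i = k then A $$ (i, j) - B $$ (i, j) else B $$ (i, j))" for k
  have C: "C k \<in> carrier_mat n n" for k by (simp add: C_def)
  have "Determinant.det A - Determinant.det B = (\<Sum>p | p permutes {0..<n}.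
      signof p * ((\<Prod>i<n. A $$ (i, p i)) - (\<Prod>i<n. B $$ (i, p i))))"
    by (simp add: det_def'[OF A] det_def'[OF B] sum_subtractf right_diff_distrib atLeast0LessThan)
  \<comment> \<open>Telescoping inside every Leibniz product and then swapping the sums yields the
    determinants of the hybrids.\<close>
  also have "\<dots> = (\<Sum>p | p permutes {0..<n}. \<Sum>k<n. signof p * (\<Prod>i<n. C k $$ (i, p i)))"
    unfolding prod_diff_telescope sum_distrib_left
    by (intro sum.cong refl arg_cong2[where f = "(*)"] prod.cong) (auto simp: C_def permutes_less)
  also have "\<dots> = (\<Sum>k<n. Determinant.det (C k))"
    by (subst sum.swap) (simp add: det_def'[OF C] atLeast0LessThan)
  finally have "cmod (Determinant.det A - Determinant.det B) \<le> (\<Sum>k<n. cmod (Determinant.det (C k)))"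
    by (metis norm_sum)
  also have "\<dots> \<le> (\<Sum>k<n. real n * \<eta> * \<beta> ^ (n - 1))"
  proof (rule sum_mono)
    fix k assume "k \<in> {..<n}"
    then have k: "k < n" by simp
    have "cmod (Determinant.det (C k)) \<le> (\<Prod>i<n. L2_set (\<lambda>j. cmod (C k $$ (i, j))) {..<n})"
      by (rule hadamard_inequality[OF C])
    also have "\<dots> = L2_set (\<lambda>j. cmod (C k $$ (k, j))) {..<n}
        * (\<Prod>i\<in>{..<n} - {k}. L2_set (\<lambda>j. cmod (C k $$ (i, j))) {..<n})"
      using k by (subst prod.remove[of _ k]) auto
    also have "\<dots> \<le> (real n * \<eta>) * (\<Prod>i\<in>{..<n} - {k}. \<beta>)"
    proof (intro mult_mono prod_mono conjI prod_nonneg)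
      \<comment> \<open>The l1 norm is a cruder bound than sqrt n times \<eta>, but it gives exactly
        the factor n of the claim.\<close>
      have "L2_set (\<lambda>j. cmod (C k $$ (k, j))) {..<n} \<le> (\<Sum>j<n. cmod (C k $$ (k, j)))"
        by (rule L2_set_le_sum) simp
      also have "\<dots> \<le> (\<Sum>j<n. \<eta>)"
        using k entries by (intro sum_mono) (auto simp: C_def)
      finally show "L2_set (\<lambda>j. cmod (C k $$ (k, j))) {..<n} \<le> real n * \<eta>" by simp
      have "0 \<le> \<eta>" using entries[OF k k] norm_ge_zero order_trans by blast
      then show "0 \<le> real n * \<eta>" by simp
    next
      fix i assume "i \<in> {..<n} - {k}"
      then have i: "i < n" "i \<noteq> k" by auto
      have "L2_set (\<lambda>j. cmod (C k $$ (i, j))) {..<n}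
          = L2_set (\<lambda>j. cmod ((if i < k then A else B) $$ (i, j))) {..<n}"
        using i by (intro L2_set_cong) (auto simp: C_def)
      then show "L2_set (\<lambda>j. cmod (C k $$ (i, j))) {..<n} \<le> \<beta>"
        using rowA[OF i(1)] rowB[OF i(1)] by (simp split: if_splits)
    qed (auto simp: L2_set_nonneg)
    also have "\<dots> = real n * \<eta> * \<beta> ^ (n - 1)" using k by simp
    finally show "cmod (Determinant.det (C k)) \<le> real n * \<eta> * \<beta> ^ (n - 1)" .
  qed
  also have "\<dots> = real n ^ 2 * \<beta> ^ (n - 1) * \<eta>" by (simp add: power2_eq_square mult_ac)
  finally show ?thesis .
qed

subsection \<open>Zeros inside a circle\<close>

text \<open>Translates the weighted sums of the argument principle and of Rouche's theorem into
  \<open>zero_count\<close>: the winding number is 1 inside the circle and 0 outside, and no zero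
  lies on the circle.\<close>

lemma sum_winding_circlepath:
  assumes "finite {p \<in> ball 0 R. f p = 0}" and "0 < r" "r < R"
    and "\<And>s. s \<in> sphere 0 r \<Longrightarrow> f s \<noteq> 0"
  shows "(\<Sum>p | p \<in> ball 0 R \<and> f p = 0. winding_number (circlepath 0 r) p * of_int (zorder f p))
    = of_int (zero_count f r)"
proof -
  have "(\<Sum>p | p \<in> ball 0 R \<and> f p = 0. winding_number (circlepath 0 r) p * of_int (zorder f p))
      = (\<Sum>p | p \<in> ball 0 r \<and> f p = 0. of_int (zorder f p))"
  proof (rule sum.mono_neutral_cong_right)
    show "\<forall>p\<in>{p \<in> ball 0 R. f p = 0} - {p \<in> ball 0 r. f p = 0}.
        winding_number (circlepath 0 r) p * of_int (zorder f p) = 0"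
    proof
      fix p assume p: "p \<in> {p \<in> ball 0 R. f p = 0} - {p \<in> ball 0 r. f p = 0}"
      then have "p \<notin> sphere 0 r" using assms(4) by blast
      with p have "p \<notin> cball 0 r" by (auto simp: dist_norm)
      then have "winding_number (circlepath 0 r) p = 0"
        using assms(2) by (intro winding_number_zero_outside[of _ "cball 0 r"]) auto
      then show "winding_number (circlepath 0 r) p * of_int (zorder f p) = 0" by simp
    qed
    fix p assume "p \<in> {p \<in> ball 0 r. f p = 0}"
    then show "winding_number (circlepath 0 r) p * of_int (zorder f p) = of_int (zorder f p)"
      by (simp add: winding_number_circlepath)
  qed (use assms in auto)
  then show ?thesis by (simp add: zero_count_def)
qed

text \<open>A point outside the closed disk is within \<open>e\<close> of its radial projection onto
  the circle.\<close>

lemma ball_subset_Union_ball: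
  fixes r e :: real
  assumes "0 < r" "0 < e"
  shows "ball 0 (r + e) \<subseteq> (\<Union>x\<in>cball (0::complex) r. ball x e)"
proof
  fix y :: complex assume y: "y \<in> ball 0 (r + e)"
  show "y \<in> (\<Union>x\<in>cball 0 r. ball x e)"
  proof (cases "norm y \<le> r")
    case True
    then show ?thesis using assms by (intro UN_I[of y]) auto
  next
    case False
    define x where "x = (r / norm y) *\<^sub>R y"
    have x: "norm x = r" using False assms by (auto simp: x_def)
    have "y - x = (1 - r / norm y) *\<^sub>R y" by (simp add: x_def scaleR_left_diff_distrib)
    then have "norm (y - x) = \<bar>1 - r / norm y\<bar> * norm y" by simp
    also have "\<dots> = norm y - r" using False assms by (auto simp: abs_if field_simps)
    finally have "norm (y - x) < e" using y by simp
    with x show ?thesis by (intro UN_I[of x]) (auto simp: dist_norm norm_minus_commute)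
  qed
qed

text \<open>Compactness gives the open neighbourhood a uniform thickness. The larger concentric ball
  then serves as the connected domain for Rouche's theorem and the argument principle.\<close>

lemma analytic_on_cball_imp_holomorphic_ball:
  fixes f :: "complex \<Rightarrow> complex"
  assumes "f analytic_on cball 0 r" "0 < r"
  obtains e where "0 < e" "f holomorphic_on ball 0 (r + e)"
proof -
  obtain S where S: "open S" "cball 0 r \<subseteq> S" "f holomorphic_on S"
    using assms(1) by (auto simp: analytic_on_holomorphic)
  obtain e where "0 < e" "(\<Union>x\<in>cball 0 r. ball x e) \<subseteq> S"
    using compact_subset_open_imp_ball_epsilon_subset[OF compact_cball S(1,2)] by blast
  with that show ?thesis
    using ball_subset_Union_ball[OF assms(2)] S(3) by (meson holomorphic_on_subset order_trans)
qed

text \<open>Zeros of a nonconstant holomorphic function are isolated, hence finite in number on a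
  compact disk; a constant with one nonzero value has none.\<close>

lemma finite_zeros_ball:
  fixes f :: "complex \<Rightarrow> complex"
  assumes "f holomorphic_on ball 0 R'" "R < R'" "z \<in> ball 0 R'" "f z \<noteq> 0"
  shows "finite {p \<in> ball 0 R. f p = 0}"
proof (cases "f constant_on ball 0 R'")
  case True
  then have "{p \<in> ball 0 R. f p = 0} = {}"
    using assms(2-4) by (fastforce simp: constant_on_def)
  then show ?thesis by (simp only: finite.emptyI)
next
  case False
  then have "finite {p \<in> cball 0 R. f p = 0}"
    using assms by (intro holomorphic_compact_finite_zeros[of f "ball 0 R'"]) (auto simp: cball_subset_ball_iff)
  then show ?thesis by (rule rev_finite_subset) auto
qed

lemma log_residue_integral_eq_zero_count:
  assumes holo: "f holomorphic_on ball 0 R" and fin: "finite {p \<in> ball 0 R. f p = 0}"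
    and r: "0 < r" "r < R" and nz: "\<And>s. s \<in> sphere 0 r \<Longrightarrow> f s \<noteq> 0"
  shows "log_residue_integral f r = of_int (zero_count f r)"
proof -
  \<comment> \<open>The argument principle with weight function 1 and an empty set of poles.\<close>
  have "contour_integral (circlepath 0 r) (\<lambda>x. deriv f x * 1 / f x)
      = 2 * pi * \<i> * (\<Sum>p | p \<in> ball 0 R \<and> (f p = 0 \<or> p \<in> {}).
          winding_number (circlepath 0 r) p * 1 * zorder f p)"
  proof (rule argument_principle)
    show "path_image (circlepath 0 r) \<subseteq> ball 0 R - {w \<in> ball 0 R. f w = 0 \<or> w \<in> {}}"
      using r nz by (auto simp: dist_norm)
    show "\<forall>z. z \<notin> ball 0 R \<longrightarrow> winding_number (circlepath 0 r) z = 0"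
      using r by (auto intro!: winding_number_zero_outside[of _ "cball 0 r"])
  qed (use holo fin in auto)
  then show ?thesis
    using sum_winding_circlepath[OF fin r nz] by (simp add: log_residue_integral_def)
qed

text \<open>Rouche's theorem for \<open>f\<close> and the perturbation \<open>g - f\<close>. The
  strict inequality also keeps both functions away from 0 on the circle, so both logarithmic
  integrals count zeros.\<close>

lemma rouche_circle:
  fixes f g :: "complex \<Rightarrow> complex"
  assumes f: "f analytic_on cball 0 r" and g: "g analytic_on cball 0 r" and r: "0 < r"
    and less: "\<And>s. s \<in> sphere 0 r \<Longrightarrow> cmod (g s - f s) < cmod (f s)"
  shows "finite {s \<in> ball 0 r. f s = 0}" "finite {s \<in> ball 0 r. g s = 0}"
    "\<And>s. s \<in> sphere 0 r \<Longrightarrow> g s \<noteq> 0"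
    "zero_count g r = zero_count f r" "log_residue_integral g r = log_residue_integral f r"
proof -
  obtain e1 where e1: "0 < e1" "f holomorphic_on ball 0 (r + e1)"
    using analytic_on_cball_imp_holomorphic_ball[OF f r] .
  obtain e2 where e2: "0 < e2" "g holomorphic_on ball 0 (r + e2)"
    using analytic_on_cball_imp_holomorphic_ball[OF g r] .
  \<comment> \<open>Both functions are holomorphic on the ball of radius \<open>R'\<close>. Halving
    the excess puts the closed ball of radius \<open>R\<close> inside it, which makes the zero sets
    in the smaller ball finite.\<close>
  define R' where "R' = r + min e1 e2"
  define R where "R = r + min e1 e2 / 2"
  have R: "r < R" "R < R'" using e1 e2 by (auto simp: R_def R'_def)
  have holo': "f holomorphic_on ball 0 R'" "g holomorphic_on ball 0 R'"
    using e1(2) e2(2) by (auto simp: R'_def elim!: holomorphic_on_subset)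
  then have holo: "f holomorphic_on ball 0 R" "g holomorphic_on ball 0 R"
    using R by (auto elim!: holomorphic_on_subset)
  have fnz: "f s \<noteq> 0" if "s \<in> sphere 0 r" for s using less[OF that] by auto
  have gnz: "g s \<noteq> 0" if "s \<in> sphere 0 r" for s
    using less[OF that] by (auto simp: norm_minus_commute)
  \<comment> \<open>The point r on the circle supplies the nonzero value needed for
    finiteness.\<close>
  have on: "of_real r \<in> sphere (0::complex) r" "of_real r \<in> ball (0::complex) R'"
    using r R by auto
  have fin: "finite {p \<in> ball 0 R. f p = 0}" "finite {p \<in> ball 0 R. g p = 0}"
    using finite_zeros_ball[OF holo'(1) R(2) on(2) fnz[OF on(1)]]
      finite_zeros_ball[OF holo'(2) R(2) on(2) gnz[OF on(1)]] by auto
  show "finite {s \<in> ball 0 r. f s = 0}" "finite {s \<in> ball 0 r. g s = 0}"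
    using R by (auto intro: finite_subset[OF _ fin(1)] finite_subset[OF _ fin(2)])
  show "\<And>s. s \<in> sphere 0 r \<Longrightarrow> g s \<noteq> 0" by (rule gnz)
  have fg: "(\<lambda>p. f p + (g p - f p)) = g" by simp
  have "(\<Sum>p | p \<in> ball 0 R \<and> f p + (g p - f p) = 0.
        winding_number (circlepath 0 r) p * zorder (\<lambda>p. f p + (g p - f p)) p)
      = (\<Sum>p | p \<in> ball 0 R \<and> f p = 0. winding_number (circlepath 0 r) p * zorder f p)"
  proof (rule Rouche_theorem)
    show "\<forall>z\<in>path_image (circlepath 0 r). cmod (g z - f z) < cmod (f z)"
      using less r by auto
    show "\<forall>z. z \<notin> ball 0 R \<longrightarrow> winding_number (circlepath 0 r) z = 0"
      using r R by (auto intro!: winding_number_zero_outside[of _ "cball 0 r"])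
  qed (use holo fin r R in \<open>auto intro!: holomorphic_intros\<close>)
  then have "complex_of_int (zero_count g r) = of_int (zero_count f r)"
    unfolding fg using sum_winding_circlepath[OF fin(1) r R(1) fnz]
      sum_winding_circlepath[OF fin(2) r R(1) gnz] by simp
  then show eq: "zero_count g r = zero_count f r" by simp
  show "log_residue_integral g r = log_residue_integral f r"
    using log_residue_integral_eq_zero_count[OF holo(1) fin(1) r R(1) fnz]
      log_residue_integral_eq_zero_count[OF holo(2) fin(2) r R(1) gnz] eq by simp
qed

section \<open>Truncated Laplace transforms are entire\<close>

lemma set_integrable_mult_bounded:
  fixes h k :: "real \<Rightarrow> complex"
  assumes h: "set_integrable lebesgue {0<..<T} h" and k: "continuous_on UNIV k"
    and bound: "\<And>t. t \<in> {0<..<T} \<Longrightarrow> cmod (k t) \<le> C"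
  shows "set_integrable lebesgue {0<..<T} (\<lambda>t. k t * h t)"
  unfolding set_integrable_def
proof (rule Bochner_Integration.integrable_bound)
  show "integrable lebesgue (\<lambda>t. of_real C * (indicator {0<..<T} t *\<^sub>R h t))"
    using h unfolding set_integrable_def by (rule integrable_mult_right)
  have "k \<in> borel_measurable lebesgue"
    using k by (intro measurable_completion) (simp add: borel_measurable_continuous_onI)
  moreover have "(\<lambda>t. indicator {0<..<T} t *\<^sub>R h t) \<in> borel_measurable lebesgue"
    using h by (auto simp: set_integrable_def)
  ultimately have "(\<lambda>t. k t * (indicator {0<..<T} t *\<^sub>R h t)) \<in> borel_measurable lebesgue"
    by measurable
  then show "(\<lambda>t. indicator {0<..<T} t *\<^sub>R (k t * h t)) \<in> borel_measurable lebesgue" by simp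
  have "cmod (k t * h t) \<le> \<bar>C\<bar> * cmod (h t)" if "t \<in> {0<..<T}" for t
    using bound[OF that] by (auto simp: norm_mult intro!: mult_right_mono)
  then show "AE t in lebesgue. norm (indicator {0<..<T} t *\<^sub>R (k t * h t))
      \<le> norm (of_real C * (indicator {0<..<T} t *\<^sub>R h t))"
    by (auto simp: indicator_def norm_mult)
qed

text \<open>On a bounded interval the exponential factor and its reciprocal are both bounded. Hence
  integrability of the Laplace integrand does not depend on the parameter.\<close>

lemma set_integrable_exp_mult_iff:
  fixes g :: "real \<Rightarrow> complex"
  shows "set_integrable lebesgue {0<..<T} (\<lambda>t. exp (c * of_real t) * g t)
    \<longleftrightarrow> set_integrable lebesgue {0<..<T} g"
proof -
  have imp: "set_integrable lebesgue {0<..<T} (\<lambda>t. exp (c * of_real t) * h t)"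
    if "set_integrable lebesgue {0<..<T} h" for c and h :: "real \<Rightarrow> complex"
  proof (rule set_integrable_mult_bounded[OF that])
    show "continuous_on UNIV (\<lambda>t. exp (c * complex_of_real t))" by (intro continuous_intros)
    fix t assume t: "t \<in> {0<..<T}"
    have "Re c * t \<le> \<bar>Re c\<bar> * T" using t by (intro mult_mono) auto
    then show "cmod (exp (c * of_real t)) \<le> exp (\<bar>Re c\<bar> * T)" by simp
  qed
  show ?thesis
    using imp[of g c] imp[of "\<lambda>t. exp (c * of_real t) * g t" "- c"]
    by (auto simp: mult.assoc[symmetric] exp_add[symmetric])
qed

text \<open>Expand the exponential and integrate termwise; the result is a power series in
  \<open>s\<close>, from which holomorphy follows.\<close>

lemma finite_laplace_sums:
  fixes g :: "real \<Rightarrow> complex"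
  assumes g: "set_integrable lebesgue {0<..<T} g"
  shows "(\<lambda>k. (LINT t:{0<..<T}|lebesgue. (- of_real t) ^ k / fact k * g t) * s ^ k)
    sums (LINT t:{0<..<T}|lebesgue. exp (- s * of_real t) * g t)"
proof -
  define F where "F k t = indicator {0<..<T} t *\<^sub>R ((- s * of_real t) ^ k / fact k * g t)"
    for k :: nat and t :: real
  \<comment> \<open>Majorant of the k-th exponential term on the interval; the absolute value keeps
    it nonnegative whatever the sign of \<open>T\<close>.\<close>
  define b where "b k = (norm s * \<bar>T\<bar>) ^ k / fact k" for k :: nat
  have int_norm: "integrable lebesgue (\<lambda>t. cmod (indicator {0<..<T} t *\<^sub>R g t))"
    using g unfolding set_integrable_def by (rule integrable_norm)
  have b: "cmod ((- s * of_real t) ^ k / fact k) \<le> b k" if "t \<in> {0<..<T}" for t k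
    using that by (auto simp: b_def norm_mult norm_divide norm_power intro!: divide_right_mono power_mono mult_mono)
  have "summable b"
    using summable_exp[of "norm s * \<bar>T\<bar>"] unfolding b_def by (simp add: divide_inverse mult.commute)
  have F_int: "integrable lebesgue (F k)" for k
    unfolding F_def set_integrable_def[symmetric]
    by (rule set_integrable_mult_bounded[OF g _ b]) (auto intro!: continuous_intros)
  have F_le: "norm (F k t) \<le> b k * cmod (indicator {0<..<T} t *\<^sub>R g t)" for k t
  proof (cases "t \<in> {0<..<T}")
    case True
    have "F k t = (- s * of_real t) ^ k / fact k * (indicator {0<..<T} t *\<^sub>R g t)"
      by (simp add: F_def)
    then have "norm (F k t) = cmod ((- s * of_real t) ^ k / fact k) * cmod (indicator {0<..<T} t *\<^sub>R g t)"
      by (simp only: norm_mult)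
    then show ?thesis using b[OF True] by (metis mult_right_mono norm_ge_zero)
  qed (simp add: F_def)
  \<comment> \<open>The exchange needs absolute summability pointwise and of the integrals; the
    series of \<open>b\<close> dominates both up to a constant factor.\<close>
  have "(\<lambda>k. integral\<^sup>L lebesgue (F k)) sums integral\<^sup>L lebesgue (\<lambda>t. \<Sum>k. F k t)"
  proof (rule sums_integral[OF F_int])
    show "AE t in lebesgue. summable (\<lambda>k. norm (F k t))"
    proof (rule AE_I2)
      fix t
      show "summable (\<lambda>k. norm (F k t))"
        by (rule summable_comparison_test'[OF summable_mult2[OF \<open>summable b\<close>], where N = 0])
          (use F_le in simp)
    qed
    have "norm (integral\<^sup>L lebesgue (\<lambda>t. norm (F k t)))
        \<le> b k * integral\<^sup>L lebesgue (\<lambda>t. cmod (indicator {0<..<T} t *\<^sub>R g t))" for k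
    proof -
      have "integral\<^sup>L lebesgue (\<lambda>t. norm (F k t))
          \<le> integral\<^sup>L lebesgue (\<lambda>t. b k * cmod (indicator {0<..<T} t *\<^sub>R g t))"
        by (rule integral_mono[OF integrable_norm[OF F_int] integrable_mult_right[OF int_norm] F_le])
      then show ?thesis using F_int by simp
    qed
    then show "summable (\<lambda>k. integral\<^sup>L lebesgue (\<lambda>t. norm (F k t)))"
      by (rule summable_comparison_test'[OF summable_mult2[OF \<open>summable b\<close>], where N = 0])
  qed
  also have "(\<lambda>t. \<Sum>k. F k t) = (\<lambda>t. indicator {0<..<T} t *\<^sub>R (exp (- s * of_real t) * g t))"
  proof
    fix t
    have "(\<lambda>k. (- s * of_real t) ^ k /\<^sub>R fact k) sums exp (- s * of_real t)" by (rule exp_converges)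
    then have "(\<lambda>k. (- s * of_real t) ^ k / fact k) sums exp (- s * of_real t)"
      by (simp add: scaleR_conv_of_real divide_inverse mult.commute)
    then have "(\<lambda>k. F k t) sums (indicator {0<..<T} t *\<^sub>R (exp (- s * of_real t) * g t))"
      unfolding F_def by (intro sums_scaleR_right sums_mult2)
    then show "(\<Sum>k. F k t) = indicator {0<..<T} t *\<^sub>R (exp (- s * of_real t) * g t)"
      by (simp add: sums_iff)
  qed
  also have "(\<lambda>k. integral\<^sup>L lebesgue (F k))
      = (\<lambda>k. (LINT t:{0<..<T}|lebesgue. (- of_real t) ^ k / fact k * g t) * s ^ k)"
  proof
    fix k
    have "F k = (\<lambda>t. (indicator {0<..<T} t *\<^sub>R ((- of_real t) ^ k / fact k * g t)) * s ^ k)"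
    proof
      fix t
      have "(- s * complex_of_real t) ^ k = (- of_real t) ^ k * s ^ k"
        unfolding power_mult_distrib[symmetric] by (simp add: mult.commute)
      then show "F k t = (indicator {0<..<T} t *\<^sub>R ((- of_real t) ^ k / fact k * g t)) * s ^ k"
        by (simp add: F_def)
    qed
    then show "integral\<^sup>L lebesgue (F k)
        = (LINT t:{0<..<T}|lebesgue. (- of_real t) ^ k / fact k * g t) * s ^ k"
      by (simp only: set_lebesgue_integral_def integral_mult_left_zero)
  qed
  finally show ?thesis unfolding set_lebesgue_integral_def .
qed

lemma truncated_transform_holomorphic: "truncated_transform T g holomorphic_on S"
proof -
  let ?I = "\<lambda>s. LINT t:{0<..<T}|lebesgue. exp (- s * of_real t) * complex_of_real (g t)"
  have "?I holomorphic_on UNIV"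
  proof (cases "set_integrable lebesgue {0<..<T} (\<lambda>t. complex_of_real (g t))")
    case True
    have "?I holomorphic_on ball 0 R" for R
      by (rule power_series_holomorphic[where z = 0]) (simp only: diff_zero, rule finite_laplace_sums[OF True])
    then have "?I field_differentiable at s" for s
      by (meson gt_ex holomorphic_on_imp_differentiable_at mem_ball_0 open_ball)
    then show ?thesis by (simp add: holomorphic_on_def)
  next
    case False
    \<comment> \<open>Non-integrability holds for all \<open>s\<close> at once, so the integral
      takes its default value 0 everywhere.\<close>
    then have "?I s = 0" for s
      using set_integrable_exp_mult_iff[of T "- s" "\<lambda>t. complex_of_real (g t)"]
      by (simp add: set_lebesgue_integral_def set_integrable_def not_integrable_integral_eq)
    then show ?thesis by (simp add: holomorphic_on_const)
  qed
  then have "?I holomorphic_on S" by (rule holomorphic_on_subset) simp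
  then show ?thesis unfolding truncated_transform_def by (intro holomorphic_intros)
qed

lemma noisy_moment_analytic: "noisy_moment L T fd n analytic_on S"
proof -
  have "noisy_moment L T fd n holomorphic_on UNIV"
    unfolding noisy_moment_def by (intro holomorphic_intros truncated_transform_holomorphic)
  then show ?thesis by (meson analytic_on_holomorphic open_UNIV subset_UNIV)
qed

subsection \<open>Hankel determinants\<close>

text \<open>This crude bound shows that the supremum defining \<open>spectral_norm\<close> is over a
  bounded set.\<close>

lemma euclid_norm_mult_le_sum_entries:
  assumes "A \<in> carrier_mat m n" "v \<in> carrier_vec n" "euclid_norm v \<le> 1"
  shows "euclid_norm (A *\<^sub>v v) \<le> (\<Sum>i<m. \<Sum>j<n. cmod (A $$ (i, j)))"
proof -
  have v: "cmod (v $ j) \<le> 1" if "j < n" for j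
    using member_le_L2_set[of "{..<n}" j "\<lambda>i. cmod (v $ i)"] that assms
    by (auto simp: euclid_norm_def)
  have "euclid_norm (A *\<^sub>v v) \<le> (\<Sum>i<m. cmod ((A *\<^sub>v v) $ i))"
    unfolding euclid_norm_def dim_mult_mat_vec carrier_matD(1)[OF assms(1)]
    by (rule L2_set_le_sum) simp
  also have "\<dots> \<le> (\<Sum>i<m. \<Sum>j<n. cmod (A $$ (i, j)))"
  proof (rule sum_mono)
    fix i assume i: "i \<in> {..<m}"
    have "cmod ((A *\<^sub>v v) $ i) = cmod (\<Sum>j<n. A $$ (i, j) * v $ j)"
      using i assms by (auto simp: scalar_prod_def atLeast0LessThan intro!: arg_cong[where f = cmod] sum.cong)
    also have "\<dots> \<le> (\<Sum>j<n. cmod (A $$ (i, j)))"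
      using v by (intro sum_norm_le) (auto simp: norm_mult intro!: mult_left_le)
    finally show "cmod ((A *\<^sub>v v) $ i) \<le> (\<Sum>j<n. cmod (A $$ (i, j)))" .
  qed
  finally show ?thesis .
qed

lemma spectral_norm_le_sum_entries:
  assumes "A \<in> carrier_mat m n"
  shows "spectral_norm A \<le> (\<Sum>i<m. \<Sum>j<n. cmod (A $$ (i, j)))"
proof -
  \<comment> \<open>The zero vector makes the index set of the supremum nonempty, also for n =
    0.\<close>
  have "0\<^sub>v n \<in> {v \<in> carrier_vec (dim_col A). euclid_norm v \<le> 1}"
    using assms by (auto simp: euclid_norm_def L2_set_def)
  then have "{v \<in> carrier_vec (dim_col A). euclid_norm v \<le> 1} \<noteq> {}" by blast
  then show ?thesis
    unfolding spectral_norm_def by (rule cSUP_least) (use assms in \<open>auto intro!: euclid_norm_mult_le_sum_entries\<close>)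
qed

text \<open>A column is the image of a standard unit vector, which competes in the supremum.\<close>

lemma column_norm_le_spectral_norm:
  assumes "A \<in> carrier_mat m n" "j < n"
  shows "L2_set (\<lambda>i. cmod (A $$ (i, j))) {..<m} \<le> spectral_norm A"
proof -
  have "euclid_norm (unit_vec n j :: complex Matrix.vec) = sqrt (\<Sum>i<n. if i = j then 1 else 0)"
    unfolding euclid_norm_def L2_set_def using assms(2)
    by (intro arg_cong[where f = sqrt] sum.cong) (simp, simp add: unit_vec_def)
  also have "\<dots> = 1" using assms(2) by simp
  finally have "unit_vec n j \<in> {v \<in> carrier_vec (dim_col A). euclid_norm v \<le> 1}"
    using assms by auto
  moreover have "bdd_above ((\<lambda>v. euclid_norm (A *\<^sub>v v)) ` {v \<in> carrier_vec (dim_col A). euclid_norm v \<le> 1})"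
    using assms(1) by (auto intro!: bdd_aboveI2 euclid_norm_mult_le_sum_entries)
  ultimately have "euclid_norm (A *\<^sub>v unit_vec n j) \<le> spectral_norm A"
    unfolding spectral_norm_def by (rule cSUP_upper)
  also have "euclid_norm (A *\<^sub>v unit_vec n j) = L2_set (\<lambda>i. cmod (A $$ (i, j))) {..<m}"
    unfolding euclid_norm_def dim_mult_mat_vec carrier_matD(1)[OF assms(1)]
    using assms by (intro L2_set_cong) auto
  finally show ?thesis .
qed

lemma hankel_mat_carrier: "hankel_mat m M s \<in> carrier_mat m m"
  by (simp add: hankel_mat_def)

lemma hankel_mat_nth: "i < m \<Longrightarrow> j < m \<Longrightarrow> hankel_mat m M s $$ (i, j) = M (i + j) s"
  by (simp add: hankel_mat_def)

text \<open>Rows and columns of a Hankel matrix coincide.\<close>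
lemma hankel_row_norm_le_spectral_norm:
  assumes "i < m"
  shows "L2_set (\<lambda>j. cmod (hankel_mat m M s $$ (i, j))) {..<m} \<le> spectral_norm (hankel_mat m M s)"
proof -
  have "L2_set (\<lambda>j. cmod (hankel_mat m M s $$ (i, j))) {..<m}
      = L2_set (\<lambda>j. cmod (hankel_mat m M s $$ (j, i))) {..<m}"
    using assms by (intro L2_set_cong) (auto simp: hankel_mat_nth add.commute)
  also have "\<dots> \<le> spectral_norm (hankel_mat m M s)"
    by (rule column_norm_le_spectral_norm[OF hankel_mat_carrier assms])
  finally show ?thesis .
qed

text \<open>The sum of the moduli of the entries dominates the spectral norm and is continuous on a
  compact set. This makes the supremum in \<open>hankel_bound\<close> usable pointwise.\<close>

lemma spectral_norm_hankel_bdd_above: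
  assumes "compact K" "\<And>n. n \<le> 2 * m - 2 \<Longrightarrow> continuous_on K (M n)"
  shows "bdd_above ((\<lambda>s. spectral_norm (hankel_mat m M s)) ` K)"
proof -
  define h where "h s = (\<Sum>i<m. \<Sum>j<m. cmod (M (i + j) s))" for s
  have "continuous_on K h"
    unfolding h_def using assms(2) by (intro continuous_intros) auto
  then have "bdd_above (h ` K)"
    using assms(1) by (intro bounded_imp_bdd_above compact_imp_bounded compact_continuous_image)
  then obtain C where C: "\<And>s. s \<in> K \<Longrightarrow> h s \<le> C" by (auto simp: bdd_above_def)
  show ?thesis
  proof (rule bdd_aboveI2)
    fix s assume "s \<in> K"
    have "spectral_norm (hankel_mat m M s) \<le> (\<Sum>i<m. \<Sum>j<m. cmod (hankel_mat m M s $$ (i, j)))"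
      by (rule spectral_norm_le_sum_entries[OF hankel_mat_carrier])
    also have "\<dots> = h s" by (simp add: h_def hankel_mat_nth)
    finally show "spectral_norm (hankel_mat m M s) \<le> C" using C[OF \<open>s \<in> K\<close>] by simp
  qed
qed

text \<open>By the Leibniz formula the determinant is a polynomial in the moments, whose indices i +
  p i are at most 2 m - 2.\<close>

lemma hankel_det_analytic:
  assumes "\<And>n. n \<le> 2 * m - 2 \<Longrightarrow> M n analytic_on S"
  shows "hankel_det m M analytic_on S"
proof -
  have "hankel_det m M = (\<lambda>s. \<Sum>p | p permutes {0..<m}. signof p * (\<Prod>i = 0..<m. M (i + p i) s))"
  proof
    fix s
    show "hankel_det m M s = (\<Sum>p | p permutes {0..<m}. signof p * (\<Prod>i = 0..<m. M (i + p i) s))"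
      unfolding hankel_det_def det_def'[OF hankel_mat_carrier]
      by (intro sum.cong refl arg_cong2[where f = "(*)"] prod.cong)
        (auto simp: hankel_mat_nth permutes_less)
  qed
  moreover have "M (i + p i) analytic_on S" if "p permutes {0..<m}" "i < m" for p i
    using permutes_less[OF that] that(2) by (intro assms) auto
  then have "(\<lambda>s. \<Sum>p | p permutes {0..<m}. signof p * (\<Prod>i = 0..<m. M (i + p i) s)) analytic_on S"
    by (intro analytic_intros) auto
  ultimately show ?thesis by simp
qed

section \<open>Comparison of the two Hankel determinants\<close>

text \<open>Turns the global smallness condition into the pointwise hypothesis of Rouche's
  theorem.\<close>

lemma hankel_det_diff_less:
  assumes r: "0 < r"
    and M: "\<And>n. n \<le> 2 * m - 2 \<Longrightarrow> continuous_on (sphere 0 r) (M n)"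
    and M': "\<And>n. n \<le> 2 * m - 2 \<Longrightarrow> continuous_on (sphere 0 r) (M' n)"
    and dist: "(MAX n\<in>{0..2 * m - 2}. SUP s\<in>sphere 0 r. cmod (M' n s - M n s)) \<le> \<eta>"
    and small: "real m ^ 2 * hankel_bound m M M' r ^ (m - 1) * \<eta> < hankel_det_min m M r"
    and s: "s \<in> sphere 0 r"
  shows "cmod (hankel_det m M' s - hankel_det m M s) < cmod (hankel_det m M s)"
proof -
  \<comment> \<open>A real supremum bounds single values only when the set is bounded above;
    continuity on the compact circle ensures this.\<close>
  have entries: "cmod (M' n s - M n s) \<le> \<eta>" if n: "n \<le> 2 * m - 2" for n
  proof -
    have "continuous_on (sphere 0 r) (\<lambda>s. cmod (M' n s - M n s))"
      using M[OF n] M'[OF n] by (intro continuous_intros)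
    then have "bdd_above ((\<lambda>s. cmod (M' n s - M n s)) ` sphere 0 r)"
      by (intro bounded_imp_bdd_above compact_imp_bounded compact_continuous_image) auto
    then have "cmod (M' n s - M n s) \<le> (SUP s\<in>sphere 0 r. cmod (M' n s - M n s))"
      using s by (intro cSUP_upper)
    also have "\<dots> \<le> (MAX n\<in>{0..2 * m - 2}. SUP s\<in>sphere 0 r. cmod (M' n s - M n s))"
      using n by (intro Max_ge) auto
    finally show ?thesis using dist by linarith
  qed
  have "bdd_above ((\<lambda>s. max (spectral_norm (hankel_mat m M s)) (spectral_norm (hankel_mat m M' s))) ` sphere 0 r)"
  proof -
    have "bdd_above ((\<lambda>s. spectral_norm (hankel_mat m M s)) ` sphere 0 r)"
      using M by (intro spectral_norm_hankel_bdd_above) auto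
    then obtain C where C: "\<And>s. s \<in> sphere 0 r \<Longrightarrow> spectral_norm (hankel_mat m M s) \<le> C"
      unfolding bdd_above_def by blast
    have "bdd_above ((\<lambda>s. spectral_norm (hankel_mat m M' s)) ` sphere 0 r)"
      using M' by (intro spectral_norm_hankel_bdd_above) auto
    then obtain C' where C': "\<And>s. s \<in> sphere 0 r \<Longrightarrow> spectral_norm (hankel_mat m M' s) \<le> C'"
      unfolding bdd_above_def by blast
    show ?thesis
      by (rule bdd_aboveI2[of _ _ "max C C'"]) (intro max.mono C C')
  qed
  then have "max (spectral_norm (hankel_mat m M s)) (spectral_norm (hankel_mat m M' s)) \<le> hankel_bound m M M' r"
    unfolding hankel_bound_def by (rule cSUP_upper[OF s])
  then have rows: "L2_set (\<lambda>j. cmod (hankel_mat m M s $$ (i, j))) {..<m} \<le> hankel_bound m M M' r"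
    "L2_set (\<lambda>j. cmod (hankel_mat m M' s $$ (i, j))) {..<m} \<le> hankel_bound m M M' r" if "i < m" for i
    using hankel_row_norm_le_spectral_norm[OF that, of M s]
      hankel_row_norm_le_spectral_norm[OF that, of M' s] by linarith+
  have "cmod (hankel_det m M' s - hankel_det m M s) \<le> real m ^ 2 * hankel_bound m M M' r ^ (m - 1) * \<eta>"
    unfolding hankel_det_def
  proof (rule det_diff_bound[OF hankel_mat_carrier hankel_mat_carrier rows(2) rows(1)])
    fix i j assume "i < m" "j < m"
    then show "cmod (hankel_mat m M' s $$ (i, j) - hankel_mat m M s $$ (i, j)) \<le> \<eta>"
      using entries[of "i + j"] by (simp add: hankel_mat_nth)
  qed
  also note small
  also have "hankel_det_min m M r \<le> cmod (hankel_det m M s)"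
    unfolding hankel_det_min_def by (intro cINF_lower[OF _ s] bdd_belowI2[of _ 0]) auto
  finally show ?thesis .
qed

theorem theorem4p3:
  fixes N m L :: nat and \<rho> \<phi> q :: "nat \<Rightarrow> real" and T \<delta> r \<eta> :: real
    and u :: "complex \<Rightarrow> real \<Rightarrow> real"
    and f :: "real \<Rightarrow> real \<Rightarrow> real"
    and noise fd :: "nat \<Rightarrow> real \<Rightarrow> real"
  defines "M \<equiv> ideal_moment N q \<rho> \<phi>"
    and "Md \<equiv> noisy_moment L T fd"
  assumes "N \<ge> 1"
    and "\<And>j. j \<in> {1..N} \<Longrightarrow> 0 \<le> \<rho> j \<and> \<rho> j < 1"
    and "\<And>j. j \<in> {1..N} \<Longrightarrow> q j \<noteq> 0"
    and "solves_heat_problem N q (\<lambda>j. rcis (\<rho> j) (\<phi> j)) u"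
    and "boundary_flux u f"
    and "m \<ge> 1" and "L \<ge> 1" and "T > 0" and "\<delta> \<ge> 0" and "r > 0"
    and "\<And>l. l \<in> {1..L} \<Longrightarrow> L2_norm_le T (noise l) \<delta>"
    and "\<And>l t. l \<in> {1..L} \<Longrightarrow> t \<in> {0<..<T} \<Longrightarrow> fd l t = f (sample_angle L l) t + noise l t"
    and "\<And>n. n \<le> 2 * m - 2 \<Longrightarrow> M n analytic_on cball 0 r"
    and "\<And>s. s \<in> sphere 0 r \<Longrightarrow> hankel_det m M s \<noteq> 0"
    and "\<eta> \<ge> 0"
    and "(MAX n\<in>{0..2 * m - 2}. SUP s\<in>sphere 0 r. cmod (Md n s - M n s)) \<le> \<eta>"
    and "real m ^ 2 * hankel_bound m M Md r ^ (m - 1) * \<eta> < hankel_det_min m M r"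
  shows "finite {s \<in> ball 0 r. hankel_det m M s = 0}
    \<and> finite {s \<in> ball 0 r. hankel_det m Md s = 0}
    \<and> (\<forall>s\<in>sphere 0 r. hankel_det m Md s \<noteq> 0)
    \<and> zero_count (hankel_det m Md) r = zero_count (hankel_det m M) r
    \<and> log_residue_integral (hankel_det m Md) r = log_residue_integral (hankel_det m M) r"
proof -
  note M = \<open>\<And>n. n \<le> 2 * m - 2 \<Longrightarrow> M n analytic_on cball 0 r\<close>
  note dist = \<open>(MAX n\<in>{0..2 * m - 2}. SUP s\<in>sphere 0 r. cmod (Md n s - M n s)) \<le> \<eta>\<close>
  note small = \<open>real m ^ 2 * hankel_bound m M Md r ^ (m - 1) * \<eta> < hankel_det_min m M r\<close>
  have Md: "Md n analytic_on cball 0 r" for n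
    unfolding Md_def by (rule noisy_moment_analytic)
  have cont: "continuous_on (sphere 0 r) g" if "g analytic_on cball 0 r" for g :: "complex \<Rightarrow> complex"
    using that by (meson analytic_imp_holomorphic continuous_on_subset
        holomorphic_on_imp_continuous_on sphere_cball)
  have "cmod (hankel_det m Md s - hankel_det m M s) < cmod (hankel_det m M s)"
    if "s \<in> sphere 0 r" for s
    by (rule hankel_det_diff_less[OF \<open>r > 0\<close> cont[OF M] cont[OF Md] dist small that])
  \<comment> \<open>This also gives finiteness of both zero sets, so the sums in
    \<open>zero_count\<close> are genuine.\<close>
  from rouche_circle[OF hankel_det_analytic[OF M] hankel_det_analytic[OF Md] \<open>r > 0\<close> this]
  show ?thesis by blast
qed

end
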